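(* Let $P$ be a finite set with partial orders $<$ and $<'$ such that $<'$ is weaker than $<$ and $\mathcal J=\mathcal J(P,<)$ is closed under $*_{P,<'}$. Let $\Psi(P,<,<')$ be the (regular) triangulation of $\mathcal R(P,<,<')$ consisting of the simplices $\Delta_{\prec,<'}$ for all linearizations $\prec$ of $<$. Then for every $w\in\overline{C(\Psi(P,<,<'))}\subset\mathbb R^{\mathcal J}$, every part of the regular subdivision $\Theta_{\mathcal R(P,<,<')}(w)$ has the form $\mathcal R(P,<'',<')$ for some partial order $<''$ on $P$ stronger than $<$.
   Context: An order ideal is a lower set; $\mathcal J(P,<)$ is the set of order ideals of $(P,<)$. An order $<'$ is weaker than $<$ (and $<$ stronger than $<'$) if $p<'q$ implies $p<q$ (equality allowed). A linearization of $<$ is a linear order stronger than $<$. $\max_<A$ is the set of $<$-maximal elements of $A\subset P$, $\mathbf 1_A\in\mathbb R^P$ the indicator vector. For $J_1,J_2\in\mathcal J(P,<')$, $J_1*_{P,<'}J_2$ is the order ideal of $(P,<')$ generated by $(J_1\cap J_2)\cap(\max_{<'}J_1\cup\max_{<'}J_2)$. If $<'$ is weaker than $<$ and $\mathcal J(P,<)$ is closed under $*_{P,<'}$, the relative poset polytope $\mathcal R(P,<,<')$ is the convex hull in $\mathbb R^P$ of the points $\mathbf 1_{\max_{<'}J}$, $J\in\mathcal J(P,<)$; these points are pairwise distinct and are exactly its vertices, so its vertex set is identified with $\mathcal J(P,<)$. (The notation $\mathcal R(P,<'',<')$ includes that $\mathcal J(P,<'')$ is closed under $*_{P,<'}$.)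 For a linearization $\prec$ of $<'$, $\Delta_{\prec,<'}$ is the simplex with vertices $\mathbf 1_{\max_{<'}J}$, $J\in\mathcal J(P,\prec)$. Regular subdivisions: for a full-dimensional polytope $Q\subset\mathbb R^n$ with vertices $v_1,\dots,v_k$ and $c\in\mathbb R^{\{v_1,\dots,v_k\}}$, let $T\subset\mathbb R^n\times\mathbb R$ be the convex hull of the rays $v_i\times\{x\le c_i\}$. $\Theta_Q(c)$ is the polyhedral subdivision of $Q$ whose parts are the projections to $\mathbb R^n$ of the bounded facets of $T$. For a subdivision $\Theta$ of this form, $C(\Theta)=\{c:\Theta_Q(c)=\Theta\}$, a relatively open polyhedral cone, with closure $\overline{C(\Theta)}$. *)

theory Defs
  imports "HOL-Analysis.Analysis"
begin

text \<open>A partial order on a set \<open>P\<close> is represented by its reflexive relation: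
  \<open>(p, q) \<in> r\<close> means \<open>p \<le> q\<close>, and \<open>p < q\<close> is \<open>(p, q) \<in> r \<and> p \<noteq> q\<close>. So an order \<open>r'\<close> on \<open>P\<close> is
  weaker than an order \<open>r\<close> on \<open>P\<close> iff \<open>r' \<subseteq> r\<close>.\<close>

definition order_ideals :: "'a set \<Rightarrow> 'a rel \<Rightarrow> 'a set set" where
  "order_ideals P r = {J. J \<subseteq> P \<and> (\<forall>q\<in>J. \<forall>p\<in>P. (p, q) \<in> r \<longrightarrow> p \<in> J)}"

definition max_elems :: "'a rel \<Rightarrow> 'a set \<Rightarrow> 'a set" where
  "max_elems r A = {p \<in> A. \<forall>q\<in>A. (p, q) \<in> r \<longrightarrow> q = p}"

definition generated_ideal :: "'a set \<Rightarrow> 'a rel \<Rightarrow> 'a set \<Rightarrow> 'a set" where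
  "generated_ideal P r A = {p \<in> P. \<exists>q\<in>A. (p, q) \<in> r}"

definition ideal_star :: "'a set \<Rightarrow> 'a rel \<Rightarrow> 'a set \<Rightarrow> 'a set \<Rightarrow> 'a set" where
  "ideal_star P r J1 J2 =
     generated_ideal P r ((J1 \<inter> J2) \<inter> (max_elems r J1 \<union> max_elems r J2))"

definition star_closed :: "'a set \<Rightarrow> 'a rel \<Rightarrow> 'a rel \<Rightarrow> bool" where
  "star_closed P r r' \<longleftrightarrow>
     (\<forall>J1 \<in> order_ideals P r. \<forall>J2 \<in> order_ideals P r. ideal_star P r' J1 J2 \<in> order_ideals P r)"

definition linearization :: "'a set \<Rightarrow> 'a rel \<Rightarrow> 'a rel \<Rightarrow> bool" where
  "linearization P r l \<longleftrightarrow> linear_order_on P l \<and> r \<subseteq> l"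

text \<open>For \<open>P\<close> a subset of a finite type \<open>'a\<close>, the space of real vectors indexed by \<open>P\<close> is the
  coordinate subspace of \<open>real ^ 'a\<close> of vectors vanishing outside \<open>P\<close>; this way \<open>P\<close> may be empty.
  If \<open>P = UNIV\<close>, it is all of \<open>real ^ 'a\<close>.\<close>

definition ideal_point :: "('a::finite) rel \<Rightarrow> 'a set \<Rightarrow> real ^ 'a" where
  "ideal_point r' J = (\<chi> p. indicator (max_elems r' J) p)"

text \<open>This is the relative poset polytope when \<open>r' \<subseteq> r\<close> and \<open>star_closed P r r'\<close>, which have to be
  required separately.\<close>

definition relative_poset_polytope :: "('a::finite) set \<Rightarrow> 'a rel \<Rightarrow> 'a rel \<Rightarrow> (real ^ 'a) set" where
  "relative_poset_polytope P r r' = convex hull (ideal_point r' ` order_ideals P r)"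

definition linearization_simplex :: "('a::finite) set \<Rightarrow> 'a rel \<Rightarrow> 'a rel \<Rightarrow> (real ^ 'a) set" where
  "linearization_simplex P l r' = convex hull (ideal_point r' ` order_ideals P l)"

definition linearization_triangulation ::
    "('a::finite) set \<Rightarrow> 'a rel \<Rightarrow> 'a rel \<Rightarrow> (real ^ 'a) set set" where
  "linearization_triangulation P r r' = {linearization_simplex P l r' | l. linearization P r l}"

definition vertices :: "'n::real_vector set \<Rightarrow> 'n set" where
  "vertices Q = {v. v extreme_point_of Q}"

definition height_region :: "'n::euclidean_space set \<Rightarrow> ('n \<Rightarrow> real) \<Rightarrow> ('n \<times> real) set" where
  "height_region Q c = convex hull {(v, x) | v x. v \<in> vertices Q \<and> x \<le> c v}"

text \<open>The library's \<^const>\<open>facet_of\<close> measures dimension relative to the affine hull of the height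
  region, so the definition also applies to a polytope that is full-dimensional only in a subspace.\<close>

definition regular_subdivision :: "'n::euclidean_space set \<Rightarrow> ('n \<Rightarrow> real) \<Rightarrow> 'n set set" where
  "regular_subdivision Q c = {fst ` F | F. F facet_of height_region Q c \<and> bounded F}"

text \<open>Weights are extensional functions on the vertex set (value \<^const>\<open>undefined\<close> elsewhere). With
  the product topology on functions they form a closed copy of the Euclidean space of real vectors
  indexed by the vertices, so \<^const>\<open>closure\<close> of a cone below is its usual closure.\<close>

definition subdivision_cone :: "'n::euclidean_space set \<Rightarrow> 'n set set \<Rightarrow> ('n \<Rightarrow> real) set" where
  "subdivision_cone Q \<Theta> = {c \<in> vertices Q \<rightarrow>\<^sub>E UNIV. regular_subdivision Q c = \<Theta>}"

end

theory Submission
  imports Defs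
begin

text \<open>Write \<open>v\<^sub>J\<close> for the vertex of an ideal \<open>J\<close>. Everything rests on the relation
  \<open>v\<^sub>A + v\<^sub>B = v\<^sub>C + v\<^sub>D\<close> with \<open>C = A \<union> B\<close> and \<open>D = A * B\<close>. Since \<open>D \<subseteq> C\<close>, some simplex of the
  triangulation contains both \<open>v\<^sub>C\<close> and \<open>v\<^sub>D\<close>, so weights in the open cone, and by continuity those
  in its closure, satisfy \<open>w A + w B \<le> w C + w D\<close>. For a bounded facet \<open>F\<close> of the height region, the
  family \<open>L\<close> of the ideals whose lifted vertices lie in \<open>F\<close> is therefore closed under \<open>\<union>\<close> and \<open>*\<close>,
  and the relation also holds for the lifted vertices of \<open>L\<close>. It follows that a maximal chain of
  \<open>L\<close> already spans \<open>F\<close> affinely, so by counting dimensions it is a full flag of subsets of \<open>P\<close>.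
  In the presence of a full flag, closure under \<open>\<union>\<close> and \<open>*\<close> implies closure under \<open>\<inter>\<close>, and so \<open>L\<close>
  consists of the order ideals of a partial order.\<close>

section \<open>Order ideals, their maximal elements, and the operation
  \<open>ideal_star\<close>\<close>

lemma partial_order_onI:
  assumes "r \<subseteq> P \<times> P" and "\<And>x. x \<in> P \<Longrightarrow> (x, x) \<in> r"
    and "\<And>x y z. (x, y) \<in> r \<Longrightarrow> (y, z) \<in> r \<Longrightarrow> (x, z) \<in> r"
    and "\<And>x y. (x, y) \<in> r \<Longrightarrow> (y, x) \<in> r \<Longrightarrow> x = y"
  shows "partial_order_on P r"
  using assms unfolding partial_order_on_def preorder_on_def
  by (auto intro!: refl_onI transI antisymI)

lemma partial_order_onD:
  assumes "partial_order_on P r"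
  shows "r \<subseteq> P \<times> P" and "\<And>x. x \<in> P \<Longrightarrow> (x, x) \<in> r"
    and "\<And>x y z. (x, y) \<in> r \<Longrightarrow> (y, z) \<in> r \<Longrightarrow> (x, z) \<in> r"
    and "\<And>x y. (x, y) \<in> r \<Longrightarrow> (y, x) \<in> r \<Longrightarrow> x = y"
  using assms unfolding partial_order_on_def preorder_on_def
  by (auto dest: refl_onD transD antisymD)

lemma order_ideals_mono: "r' \<subseteq> r \<Longrightarrow> order_ideals P r \<subseteq> order_ideals P r'"
  unfolding order_ideals_def by blast

lemma order_ideals_subset: "J \<in> order_ideals P r \<Longrightarrow> J \<subseteq> P"
  unfolding order_ideals_def by blast

lemma order_idealsD: "J \<in> order_ideals P r \<Longrightarrow> q \<in> J \<Longrightarrow> p \<in> P \<Longrightarrow> (p, q) \<in> r \<Longrightarrow> p \<in> J"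
  unfolding order_ideals_def by blast

lemma empty_order_ideal: "{} \<in> order_ideals P r"
  unfolding order_ideals_def by blast

lemma Un_order_ideals:
  "J1 \<in> order_ideals P r \<Longrightarrow> J2 \<in> order_ideals P r \<Longrightarrow> J1 \<union> J2 \<in> order_ideals P r"
  unfolding order_ideals_def by blast

lemma ideal_star_subset:
  assumes "J1 \<in> order_ideals P r" "J2 \<in> order_ideals P r"
  shows "ideal_star P r J1 J2 \<subseteq> J1 \<inter> J2"
  using assms unfolding ideal_star_def generated_ideal_def order_ideals_def by blast

lemma mem_ideal_star:
  assumes "partial_order_on P r" "J1 \<subseteq> P" "p \<in> max_elems r J1" "p \<in> J2"
  shows "p \<in> ideal_star P r J1 J2" "p \<in> ideal_star P r J2 J1"
  using assms partial_order_onD(2)[OF assms(1)]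
  unfolding ideal_star_def generated_ideal_def max_elems_def by blast+

lemma max_elems_anti_mono: "p \<in> max_elems r A \<Longrightarrow> p \<in> B \<Longrightarrow> B \<subseteq> A \<Longrightarrow> p \<in> max_elems r B"
  unfolding max_elems_def by blast

text \<open>An element of only one of the two ideals lies below nothing in the other, because ideals
  are lower sets. So only elements of the intersection face a condition from both sides.\<close>

lemma max_elems_Un:
  assumes po: "partial_order_on P r" and J: "J1 \<in> order_ideals P r" "J2 \<in> order_ideals P r"
  shows "max_elems r (J1 \<union> J2) =
    {p \<in> max_elems r J1 \<union> max_elems r J2. p \<in> J1 \<inter> J2 \<longrightarrow> p \<in> max_elems r J1 \<inter> max_elems r J2}"
proof -
  have "p \<in> J1" if "q \<in> J1" "(p, q) \<in> r" for p q
    using that order_idealsD[OF J(1)] partial_order_onD(1)[OF po] by blast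
  moreover have "p \<in> J2" if "q \<in> J2" "(p, q) \<in> r" for p q
    using that order_idealsD[OF J(2)] partial_order_onD(1)[OF po] by blast
  ultimately show ?thesis unfolding max_elems_def by (auto; metis)
qed

text \<open>The generators of the star are pairwise incomparable: each is maximal in
  \<open>J1\<close> or in \<open>J2\<close>, and both contain the star. Every element of the star
  lies below a generator, so no other element is maximal.\<close>

lemma max_elems_ideal_star:
  assumes po: "partial_order_on P r" and J: "J1 \<in> order_ideals P r" "J2 \<in> order_ideals P r"
  shows "max_elems r (ideal_star P r J1 J2) = (max_elems r J1 \<union> max_elems r J2) \<inter> J1 \<inter> J2"
proof -
  let ?S = "ideal_star P r J1 J2"
  have P: "J1 \<subseteq> P" "J2 \<subseteq> P" using J order_ideals_subset by auto
  have in_star: "p \<in> ?S" if p: "p \<in> max_elems r J1 \<union> max_elems r J2" "p \<in> J1" "p \<in> J2" for p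
    using p(1)
  proof
    assume "p \<in> max_elems r J1" then show ?thesis using mem_ideal_star(1)[OF po P(1)] p(3) by simp
  next
    assume "p \<in> max_elems r J2" then show ?thesis using mem_ideal_star(2)[OF po P(2)] p(2) by simp
  qed
  have sub: "?S \<subseteq> J1" "?S \<subseteq> J2" using ideal_star_subset[OF J] by auto
  have "p \<in> max_elems r ?S"
    if p: "p \<in> max_elems r J1 \<union> max_elems r J2" "p \<in> J1" "p \<in> J2" for p
    using p(1) max_elems_anti_mono[OF _ in_star[OF p]] sub by auto
  moreover have "p \<in> max_elems r J1 \<union> max_elems r J2 \<and> p \<in> J1 \<and> p \<in> J2"
    if p: "p \<in> max_elems r ?S" for p
  proof -
    have "p \<in> ?S" using p by (simp add: max_elems_def)
    then obtain q where q: "q \<in> J1" "q \<in> J2" "q \<in> max_elems r J1 \<union> max_elems r J2" "(p, q) \<in> r"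
      unfolding ideal_star_def generated_ideal_def by blast
    then have "q = p" using p in_star[of q] by (simp add: max_elems_def)
    with q show ?thesis by simp
  qed
  ultimately show ?thesis by blast
qed

lemma ideal_point_nth: "ideal_point r J $ p = (if p \<in> max_elems r J then 1 else 0)"
  by (simp add: ideal_point_def indicator_def)

text \<open>Compare coordinates at \<open>p\<close>. If \<open>p\<close> lies in both ideals, being
  maximal in both gives one unit to the union and one to the star, and being maximal in just one
  gives a single unit to the star. If \<open>p\<close> lies in one ideal only, its unit goes to the
  union.\<close>

lemma ideal_point_add:
  assumes po: "partial_order_on P r" and J: "J1 \<in> order_ideals P r" "J2 \<in> order_ideals P r"
  shows "ideal_point r J1 + ideal_point r J2 =
         ideal_point r (J1 \<union> J2) + ideal_point r (ideal_star P r J1 J2)"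
proof -
  have "max_elems r J1 \<subseteq> J1" "max_elems r J2 \<subseteq> J2" by (auto simp: max_elems_def)
  then show ?thesis
    unfolding vec_eq_iff vector_add_component ideal_point_nth
      max_elems_Un[OF assms] max_elems_ideal_star[OF assms] by auto
qed

section \<open>Full flags of subsets, and families of sets that are ideal lattices\<close>

lemma card_chain_le:
  assumes "finite A" "subset.chain (Pow A) K"
  shows "card K \<le> card A + 1"
proof -
  have sub: "X \<subseteq> A" if "X \<in> K" for X using assms(2) that by (auto simp: subset_chain_def)
  have "inj_on card K"
  proof (rule inj_onI)
    fix X Y assume XY: "X \<in> K" "Y \<in> K" "card X = card Y"
    then have "X \<subseteq> Y \<or> Y \<subseteq> X" using assms(2) by (auto simp: subset_chain_def)
    moreover have "finite X" "finite Y" using XY sub assms(1) finite_subset by blast+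
    ultimately show "X = Y" using XY(3) card_subset_eq by metis
  qed
  moreover have "card ` K \<subseteq> {..card A}" using sub assms(1) by (auto intro: card_mono)
  ultimately have "card K \<le> card {..card A}" by (intro card_inj_on_le) auto
  then show ?thesis by simp
qed

text \<open>Deleting \<open>p\<close> from all members gives a chain of subsets of
  \<open>P - {p}\<close>, which is too small to carry \<open>card P + 1\<close> distinct members. So
  two members collapse, and they differ exactly by \<open>p\<close>.\<close>

lemma long_chain_insert:
  assumes fin: "finite P" and ch: "subset.chain (Pow P) K" and card: "card P + 1 \<le> card K"
    and p: "p \<in> P"
  obtains X where "X \<in> K" "p \<notin> X" "insert p X \<in> K"
proof -
  have "\<not> inj_on (\<lambda>X. X - {p}) K"
  proof
    assume "inj_on (\<lambda>X. X - {p}) K"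
    then have "card K = card ((\<lambda>X. X - {p}) ` K)" by (simp add: card_image)
    moreover have "subset.chain (Pow (P - {p})) ((\<lambda>X. X - {p}) ` K)"
      using ch unfolding subset_chain_def by (auto; blast)
    ultimately have "card K \<le> card (P - {p}) + 1" using fin card_chain_le by (metis finite_Diff)
    moreover have "card P > 0" using p fin by (auto simp: card_gt_0_iff)
    ultimately show False using card p by simp
  qed
  then obtain X Y where "X \<in> K" "Y \<in> K" "X \<noteq> Y" "X - {p} = Y - {p}"
    by (auto simp: inj_on_def)
  then have "p \<notin> X \<and> Y = insert p X \<or> p \<notin> Y \<and> X = insert p Y" by blast
  with \<open>X \<in> K\<close> \<open>Y \<in> K\<close> that show ?thesis by blast
qed

text \<open>A finite family of sets that covers \<open>P\<close>, contains the empty set and is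
  closed under union and intersection is the family of lower sets of a preorder. The full flag
  \<open>K\<close> yields the empty set, the covering, the antisymmetry of the preorder and,
  together with stars, the intersections.\<close>

lemma star_closed_family_eq_order_ideals:
  fixes P :: "'a set"
  assumes fin: "finite P" and po': "partial_order_on P r'" and "r' \<subseteq> r" and "r \<subseteq> P \<times> P"
    and L: "L \<subseteq> order_ideals P r"
    and Un: "\<And>A B. A \<in> L \<Longrightarrow> B \<in> L \<Longrightarrow> A \<union> B \<in> L"
    and star: "\<And>A B. A \<in> L \<Longrightarrow> B \<in> L \<Longrightarrow> ideal_star P r' A B \<in> L"
    and K: "K \<subseteq> L" "subset.chain (Pow P) K" "card P + 1 \<le> card K"
  shows "\<exists>r''. partial_order_on P r'' \<and> r \<subseteq> r'' \<and> order_ideals P r'' = L"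
proof -
  have L': "A \<in> order_ideals P r'" if "A \<in> L" for A
    using that L order_ideals_mono[OF \<open>r' \<subseteq> r\<close>] by blast
  have LP: "A \<subseteq> P" if "A \<in> L" for A using that L order_ideals_subset by blast
  have finL: "finite L" using LP fin by (meson finite_Pow_iff finite_subset PowI subsetI)
  have flag: "\<exists>X. X \<in> K \<and> p \<notin> X \<and> insert p X \<in> K" if "p \<in> P" for p
    using long_chain_insert[OF fin K(2,3) that] by blast
  have "K \<noteq> {}" using K(3) by auto
  moreover have "finite K" using K(1) finL finite_subset by blast
  \<comment> \<open>The least member of the flag is empty, since every \<open>p\<close> in
    \<open>P\<close> is missing from some member.\<close>
  ultimately have "\<Inter>K \<in> K" using Inter_in_chain K(2) by blast
  moreover have "\<Inter>K = {}"
  proof (rule ccontr)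
    assume "\<Inter>K \<noteq> {}"
    then obtain p where "p \<in> \<Inter>K" by blast
    moreover have "p \<in> P" using \<open>\<Inter>K \<in> K\<close> \<open>p \<in> \<Inter>K\<close> K(1) LP by blast
    ultimately show False using flag by blast
  qed
  ultimately have empty: "{} \<in> L" using K(1) by auto
  have Union: "\<Union>\<A> \<in> L" if "\<A> \<subseteq> L" for \<A>
  proof -
    have "finite \<A>" using that finL finite_subset by blast
    then show ?thesis using that by (induction) (auto simp: empty Un)
  qed
  \<comment> \<open>In a flag step from \<open>X\<close> to \<open>insert p X\<close> the new
    element is maximal: an element of \<open>X\<close> above \<open>p\<close> would force
    \<open>p\<close> into the ideal \<open>X\<close>.\<close>
  have max: "\<exists>M\<in>L. p \<in> max_elems r' M" if p: "p \<in> P" for p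
  proof -
    obtain X where X: "X \<in> K" "p \<notin> X" "insert p X \<in> K" using flag[OF p] by blast
    then have "X \<in> order_ideals P r'" using K(1) L' by blast
    with X(2) p have "p \<in> max_elems r' (insert p X)"
      using order_idealsD unfolding max_elems_def by fastforce
    with X K(1) show ?thesis by blast
  qed
  have Int: "A \<inter> B \<in> L" if AB: "A \<in> L" "B \<in> L" for A B
  proof -
    \<comment> \<open>Starring with some \<open>M\<close> that has \<open>p\<close> as a maximal element makes \<open>p\<close> maximal in the
      smaller ideals, so the outer star does not lose it.\<close>
    have "\<exists>C\<in>L. p \<in> C \<and> C \<subseteq> A \<inter> B" if p: "p \<in> A \<inter> B" for p
    proof -
      obtain M where M: "M \<in> L" "p \<in> max_elems r' M" using max p AB LP by blast
      have in_star: "p \<in> max_elems r' (ideal_star P r' C M)" "ideal_star P r' C M \<subseteq> C"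
        "ideal_star P r' C M \<in> L" if C: "C \<in> L" "p \<in> C" for C
      proof -
        have "p \<in> M" using M(2) by (simp add: max_elems_def)
        then show "p \<in> max_elems r' (ideal_star P r' C M)"
          using M(2) C max_elems_ideal_star[OF po' L' L'] M(1) by blast
        show "ideal_star P r' C M \<subseteq> C" using ideal_star_subset[OF L' L'] C(1) M(1) by blast
        show "ideal_star P r' C M \<in> L" using star C(1) M(1) by blast
      qed
      let ?C = "ideal_star P r' (ideal_star P r' A M) (ideal_star P r' B M)"
      have pA: "p \<in> A" and pB: "p \<in> B" using p by auto
      have "?C \<in> L" using star in_star(3) AB pA pB by blast
      moreover have "?C \<subseteq> ideal_star P r' A M \<inter> ideal_star P r' B M"
        using ideal_star_subset[OF L' L'] in_star(3) AB pA pB by blast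
      moreover have "p \<in> ?C"
        using mem_ideal_star(1)[OF po' LP] in_star(3,1) AB pA pB
        by (metis (no_types, lifting) max_elems_def mem_Collect_eq)
      ultimately show ?thesis using in_star(2) AB pA pB by blast
    qed
    then have "A \<inter> B = \<Union>{C \<in> L. C \<subseteq> A \<inter> B}" by blast
    also have "\<dots> \<in> L" by (rule Union) blast
    finally show ?thesis .
  qed
  \<comment> \<open>The largest relation on \<open>P\<close> for which all members of
    \<open>L\<close> are lower sets.\<close>
  define r'' where "r'' = {(p, q) \<in> P \<times> P. \<forall>J\<in>L. q \<in> J \<longrightarrow> p \<in> J}"
  have "partial_order_on P r''"
  proof (rule partial_order_onI)
    fix p q assume pq: "(p, q) \<in> r''" "(q, p) \<in> r''"
    \<comment> \<open>Here \<open>p\<close> and \<open>q\<close> lie in the same members of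
      \<open>L\<close>, but the flag separates \<open>p\<close> from every other element.\<close>
    obtain X where X: "X \<in> K" "p \<notin> X" "insert p X \<in> K" 
      using flag[of p] pq by (auto simp only: r''_def)
    then have "q \<notin> X" "q \<in> insert p X" using pq K(1) unfolding r''_def by blast+
    then show "p = q" by blast
  qed (auto simp: r''_def)
  moreover have "r \<subseteq> r''"
  proof clarify
    fix p q assume pq: "(p, q) \<in> r"
    then have "p \<in> J" if "J \<in> L" "q \<in> J" for J
      using that L order_idealsD[of J P r q p] \<open>r \<subseteq> P \<times> P\<close> by blast
    with pq \<open>r \<subseteq> P \<times> P\<close> show "(p, q) \<in> r''" unfolding r''_def by blast
  qed
  moreover have "L \<subseteq> order_ideals P r''"
    using LP unfolding order_ideals_def r''_def by blast
  moreover have "order_ideals P r'' \<subseteq> L"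
  proof
    fix J assume J: "J \<in> order_ideals P r''"
    have "\<exists>C\<in>L. q \<in> C \<and> C \<subseteq> J" if "q \<in> J" for q
    proof -
      let ?A = "{C \<in> L. q \<in> C}"
      have "q \<in> P" using J that order_ideals_subset by blast
      then have "?A \<noteq> {}" using flag[of q] K(1) by blast
      \<comment> \<open>The least member of \<open>L\<close> containing \<open>q\<close> is the
        principal ideal of \<open>q\<close> for \<open>r''\<close>.\<close>
      then have "\<Inter>?A \<in> ?A" using finL Int by (intro finite_Inf_in) auto
      moreover have "\<Inter>?A \<subseteq> J"
      proof
        fix p assume "p \<in> \<Inter>?A"
        moreover from this have "p \<in> P" using \<open>?A \<noteq> {}\<close> LP by blast
        ultimately have "(p, q) \<in> r''" using \<open>q \<in> P\<close> by (auto simp: r''_def)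
        then show "p \<in> J" using order_idealsD[OF J that \<open>p \<in> P\<close>] by blast
      qed
      ultimately show ?thesis by blast
    qed
    then have "J = \<Union>{C \<in> L. C \<subseteq> J}" by blast
    also have "\<dots> \<in> L" by (rule Union) blast
    finally show "J \<in> L" .
  qed
  ultimately show ?thesis by blast
qed

section \<open>Linear extensions with prescribed ideals\<close>

lemma linear_extension:
  fixes P :: "'a::finite set"
  assumes "partial_order_on P r"
  shows "\<exists>l. linearization P r l"
proof -
  let ?E = "{l. partial_order_on P l \<and> r \<subseteq> l}"
  have "finite ?E" "?E \<noteq> {}" using assms by auto
  then obtain l where l: "partial_order_on P l" "r \<subseteq> l"
    and maxl: "\<And>m. partial_order_on P m \<Longrightarrow> r \<subseteq> m \<Longrightarrow> l \<subseteq> m \<Longrightarrow> l = m"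
    using finite_has_maximal[of ?E] by blast
  note lD = partial_order_onD[OF l(1)]
  have "total_on P l"
    unfolding total_on_def
  proof (intro ballI impI, rule ccontr)
    fix x y assume xy: "x \<in> P" "y \<in> P" "x \<noteq> y" "\<not> ((x, y) \<in> l \<or> (y, x) \<in> l)"
    \<comment> \<open>The transitive closure of \<open>l\<close> with the pair \<open>(x, y)\<close>
      added. It is still antisymmetric because \<open>y\<close> is not below \<open>x\<close>, so it
      contradicts the maximality of \<open>l\<close>.\<close>
    let ?m = "l \<union> {(a, b). (a, x) \<in> l \<and> (y, b) \<in> l}"
    have "partial_order_on P ?m"
    proof (rule partial_order_onI)
      show "?m \<subseteq> P \<times> P" using lD(1) by blast
      show "(a, a) \<in> ?m" if "a \<in> P" for a using lD(2) that by blast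
      show "(a, c) \<in> ?m" if "(a, b) \<in> ?m" "(b, c) \<in> ?m" for a b c
        using that lD(3)[of a b c] lD(3)[of a b x] lD(3)[of y b c] lD(3)[of y b x] xy(4) by auto
      show "a = b" if "(a, b) \<in> ?m" "(b, a) \<in> ?m" for a b
        using that lD(4)[of a b] lD(3)[of y a b] lD(3)[of y b a] lD(3)[of y a x] lD(3)[of y b x]
          xy(4) by auto
    qed
    then have "l = ?m" using maxl l(2) by blast
    moreover have "(x, y) \<in> ?m" using lD(2) xy by blast
    ultimately show False using xy(4) by blast
  qed
  then show ?thesis using l unfolding linearization_def linear_order_on_def by blast
qed

text \<open>Order \<open>P\<close> in three blocks, first \<open>A\<close>, then
  \<open>B - A\<close>, then the rest, and by \<open>r\<close> within each block. This order extends
  \<open>r\<close> because \<open>A\<close> and \<open>B\<close> are ideals, and any linear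
  extension of it keeps the blocks in sequence.\<close>

lemma linearization_through_ideals:
  fixes P :: "'a::finite set"
  assumes po: "partial_order_on P r" and A: "A \<in> order_ideals P r" and B: "B \<in> order_ideals P r"
    and "A \<subseteq> B"
  obtains l where "linearization P r l" "A \<in> order_ideals P l" "B \<in> order_ideals P l"
proof -
  note rD = partial_order_onD[OF po]
  define k :: "'a \<Rightarrow> nat" where "k p = (if p \<in> A then 0 else if p \<in> B then 1 else 2)" for p
  define m where "m = {(p, q) \<in> P \<times> P. k p < k q \<or> k p = k q \<and> (p, q) \<in> r}"
  have k_mono: "k p \<le> k q" if pq: "(p, q) \<in> r" for p q
  proof -
    have "p \<in> P" using pq rD(1) by blast
    then have "q \<in> A \<longrightarrow> p \<in> A" "q \<in> B \<longrightarrow> p \<in> B"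
      using pq order_idealsD[OF A, of q p] order_idealsD[OF B, of q p] by simp_all
    then show ?thesis using \<open>A \<subseteq> B\<close> by (auto simp: k_def)
  qed
  have "partial_order_on P m"
  proof (rule partial_order_onI)
    show "(a, a) \<in> m" if "a \<in> P" for a using that rD(2) by (simp add: m_def)
    show "(a, c) \<in> m" if "(a, b) \<in> m" "(b, c) \<in> m" for a b c
      using that rD(3)[of a b c] by (auto simp: m_def)
    show "a = b" if "(a, b) \<in> m" "(b, a) \<in> m" for a b
      using that rD(4)[of a b] by (auto simp: m_def)
  qed (auto simp: m_def)
  then obtain l where l: "linearization P m l" using linear_extension by blast
  have "r \<subseteq> m"
  proof clarify
    fix p q assume pq: "(p, q) \<in> r"
    with rD(1) k_mono[OF pq] show "(p, q) \<in> m" by (auto simp: m_def)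
  qed
  then have "linearization P r l" using l unfolding linearization_def by blast
  moreover have ideal: "C \<in> order_ideals P l"
    if C: "C \<subseteq> P" "\<And>p q. p \<in> C \<Longrightarrow> q \<in> P - C \<Longrightarrow> k p < k q" for C
  proof -
    have po_l: "partial_order_on P l" and "m \<subseteq> l"
      using l unfolding linearization_def linear_order_on_def by auto
    have "p \<in> C" if "q \<in> C" "p \<in> P" "(p, q) \<in> l" for p q
    proof (rule ccontr)
      assume "p \<notin> C"
      then have "(q, p) \<in> m" using that C unfolding m_def by blast
      then have "p = q" using \<open>m \<subseteq> l\<close> that(3) partial_order_onD(4)[OF po_l] by blast
      with \<open>p \<notin> C\<close> that(1) show False by blast
    qed
    with C(1) show ?thesis unfolding order_ideals_def by blast
  qed
  moreover have "A \<in> order_ideals P l" "B \<in> order_ideals P l"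
    using order_ideals_subset[OF A] order_ideals_subset[OF B] \<open>A \<subseteq> B\<close>
    by (intro ideal; auto simp: k_def)+
  ultimately show ?thesis using that by blast
qed

section \<open>Bounded faces of the height region\<close>

text \<open>\<open>S\<close> need not be compact, as it will be a union of rays. The set
  \<open>?D\<close> of points that satisfy the claim is convex, since a face containing an inner
  point of a segment contains its ends; and \<open>?D\<close> contains \<open>S\<close>.\<close>

lemma face_of_convex_hull_eq:
  assumes F: "F face_of convex hull S"
  shows "F = convex hull (F \<inter> S)"
proof
  let ?D = "{x \<in> convex hull S. x \<in> F \<longrightarrow> x \<in> convex hull (F \<inter> S)}"
  have "convex ?D"
  proof (rule convex_contains_open_segment[THEN iffD2], intro ballI subsetI)
    fix a b x assume ab: "a \<in> ?D" "b \<in> ?D" and x: "x \<in> open_segment a b"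
    then have xS: "x \<in> convex hull S"
      using convex_contains_open_segment convex_convex_hull by blast
    moreover have "x \<in> convex hull (F \<inter> S)" if "x \<in> F"
    proof -
      have "a \<in> F" "b \<in> F" using face_ofD[OF F x _ _ that] ab by auto
      then show ?thesis
        using ab x convex_contains_open_segment[of "convex hull (F \<inter> S)"] convex_convex_hull by blast
    qed
    ultimately show "x \<in> ?D" by simp
  qed
  moreover have "S \<subseteq> ?D" by (auto intro: hull_inc)
  ultimately have "convex hull S \<subseteq> ?D" by (intro hull_minimal)
  then show "F \<subseteq> convex hull (F \<inter> S)" using face_of_imp_subset[OF F] by blast
  show "convex hull (F \<inter> S) \<subseteq> F"
    using face_of_imp_convex[OF F] by (intro hull_minimal) auto
qed

lemma midpoint_in_convex: "convex S \<Longrightarrow> a \<in> S \<Longrightarrow> b \<in> S \<Longrightarrow> midpoint a b \<in> S"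
  using closed_segment_subset midpoint_in_closed_segment by blast

lemma height_region_downward:
  assumes "(z, y) \<in> height_region Q c" "x \<le> y"
  shows "(z, x) \<in> height_region Q c"
proof -
  let ?G = "{(v, x) | v x. v \<in> vertices Q \<and> x \<le> c v}"
  let ?d = "(0, y - x)"
  have "?G \<subseteq> {u. u - ?d \<in> height_region Q c}"
  proof clarsimp
    fix v t assume "v \<in> vertices Q" "t \<le> c v"
    then have "t + x - y \<le> c v" using assms(2) by simp
    then show "(v, t - (y - x)) \<in> height_region Q c"
      unfolding height_region_def using \<open>v \<in> vertices Q\<close> by (intro hull_inc) simp
  qed
  moreover have "convex {u. u - ?d \<in> height_region Q c}"
  proof -
    have "{u. u - ?d \<in> height_region Q c} = (+) ?d ` height_region Q c"
      by (auto simp: image_iff algebra_simps intro!: bexI[of _ "_ - ?d"])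
    then show ?thesis unfolding height_region_def by (simp add: convex_translation)
  qed
  ultimately have "height_region Q c \<subseteq> {u. u - ?d \<in> height_region Q c}"
    unfolding height_region_def by (intro hull_minimal)
  then have "(z, y) - ?d \<in> height_region Q c" using assms(1) by blast
  then show ?thesis by simp
qed

text \<open>A point of the region above \<open>(z, y)\<close> would put \<open>(z, y)\<close>
  strictly between it and every lower point over \<open>z\<close>. The face would then contain a
  whole downward ray.\<close>

lemma bounded_face_height_region_top:
  assumes F: "F face_of height_region Q c" and bnd: "bounded F"
    and zy: "(z, y) \<in> F" and zy': "(z, y') \<in> height_region Q c"
  shows "y' \<le> y"
proof (rule ccontr)
  assume "\<not> y' \<le> y"
  have ray: "(z, x) \<in> F" if x: "x < y" for x
  proof -
    have zx: "(z, x) \<in> height_region Q c"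
      using height_region_downward face_of_imp_subset[OF F] zy x by (metis less_imp_le subsetD)
    define u where "u = (y - x) / (y' - x)"
    have u: "0 < u" "u < 1" "u * (y' - x) = y - x"
      using x \<open>\<not> y' \<le> y\<close> by (auto simp: u_def field_simps)
    have "(z, y) = (1 - u) *\<^sub>R (z, x) + u *\<^sub>R (z, y')"
      using u(3) by (simp add: algebra_simps)
    moreover have "(z, x) \<noteq> (z, y')" using x \<open>\<not> y' \<le> y\<close> by auto
    ultimately have "(z, y) \<in> open_segment (z, x) (z, y')"
      using u unfolding in_segment by blast
    then show ?thesis using face_ofD[OF F _ zx zy' zy] by blast
  qed
  obtain B where B: "\<And>u. u \<in> F \<Longrightarrow> norm u \<le> B" using bnd bounded_iff by metis
  \<comment> \<open>Below \<open>y\<close>, and so far down that the absolute value of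
    \<open>x\<close> alone exceeds the bound \<open>B\<close>.\<close>
  define x where "x = min (y - 1) (- B - 1)"
  have "norm (z, x) \<le> B" using B ray by (simp add: x_def)
  moreover have "\<bar>x\<bar> \<le> norm (z, x)" using norm_snd_le[of x z] by simp
  ultimately show False by (simp add: x_def min_def split: if_splits)
qed

text \<open>A face is spanned by the generators it contains, and a bounded one can meet the ray over
  a vertex only at its top.\<close>

lemma bounded_face_height_region_eq:
  assumes F: "F face_of height_region Q c" and bnd: "bounded F"
  shows "F = convex hull {(v, c v) | v. v \<in> vertices Q \<and> (v, c v) \<in> F}"
proof -
  let ?G = "{(v, x) | v x. v \<in> vertices Q \<and> x \<le> c v}"
  have "F \<inter> ?G = {(v, c v) | v. v \<in> vertices Q \<and> (v, c v) \<in> F}"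
  proof safe
    fix v x assume v: "v \<in> vertices Q" "x \<le> c v" "(v, x) \<in> F"
    have "(v, c v) \<in> height_region Q c"
      unfolding height_region_def using v(1) by (intro hull_inc) simp
    then have "c v = x" using bounded_face_height_region_top[OF F bnd v(3)] v(2) by (intro antisym)
    with v show "\<exists>va. (v, x) = (va, c va) \<and> va \<in> vertices Q \<and> (va, c va) \<in> F" by blast
  qed auto
  then show ?thesis
    using face_of_convex_hull_eq[of F ?G] F unfolding height_region_def by simp
qed

lemma fst_bounded_face_height_region:
  assumes "F face_of height_region Q c" "bounded F"
  shows "fst ` F = convex hull {v \<in> vertices Q. (v, c v) \<in> F}"
proof -
  have "fst ` F = fst ` (convex hull {(v, c v) | v. v \<in> vertices Q \<and> (v, c v) \<in> F})"
    using arg_cong[OF bounded_face_height_region_eq[OF assms], of "image fst"] .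
  also have "\<dots> = convex hull (fst ` {(v, c v) | v. v \<in> vertices Q \<and> (v, c v) \<in> F})"
    by (rule convex_hull_linear_image[OF linear_fst])
  also have "fst ` {(v, c v) | v. v \<in> vertices Q \<and> (v, c v) \<in> F} = {v \<in> vertices Q. (v, c v) \<in> F}"
    by force
  finally show ?thesis .
qed

section \<open>Vertices of the relative poset polytope and their lifts\<close>

text \<open>The hull lies in the unit cube. In each coordinate \<open>x\<close> attains the bound 0
  or 1, so both ends of a segment with \<open>x\<close> inside attain the same bound and the ends
  coincide.\<close>

lemma extreme_point_of_convex_hull_01:
  fixes x :: "real ^ 'n"
  assumes "x \<in> S" and S: "\<And>y i. y \<in> S \<Longrightarrow> y $ i = 0 \<or> y $ i = 1"
  shows "x extreme_point_of convex hull S"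
proof -
  have box: "0 \<le> y $ i \<and> y $ i \<le> 1" if "y \<in> convex hull S" for y i
  proof -
    have "S \<subseteq> cbox 0 1"
    proof
      fix u assume "u \<in> S"
      then have "0 \<le> u $ j \<and> u $ j \<le> 1" for j using S[of u j] by auto
      then show "u \<in> cbox 0 1" by (simp add: mem_box_cart)
    qed
    then have "convex hull S \<subseteq> cbox 0 1" by (intro hull_minimal) auto
    then show ?thesis using that by (auto simp: mem_box_cart)
  qed
  have "x \<notin> open_segment a b" if ab: "a \<in> convex hull S" "b \<in> convex hull S" for a b
  proof
    assume "x \<in> open_segment a b"
    then obtain u where u: "a \<noteq> b" "0 < u" "u < 1" "x = (1 - u) *\<^sub>R a + u *\<^sub>R b"
      by (auto simp: in_segment)
    have "a $ i = b $ i" for i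
    proof -
      have xi: "x $ i = (1 - u) * a $ i + u * b $ i" using u(4) by simp
      have a: "0 \<le> a $ i" "a $ i \<le> 1" and b: "0 \<le> b $ i" "b $ i \<le> 1" using box ab by auto
      show ?thesis
      proof (cases "x $ i = 0")
        case True
        moreover have "0 \<le> (1 - u) * a $ i" "0 \<le> u * b $ i" using a b u by simp_all
        ultimately have "(1 - u) * a $ i = 0" "u * b $ i = 0" using xi by linarith+
        then show ?thesis using u by simp
      next
        case False
        then have "(1 - u) * (1 - a $ i) + u * (1 - b $ i) = 0"
          using S[OF \<open>x \<in> S\<close>, of i] xi by (simp add: algebra_simps)
        moreover have "0 \<le> (1 - u) * (1 - a $ i)" "0 \<le> u * (1 - b $ i)" using a b u by simp_all
        ultimately have "(1 - u) * (1 - a $ i) = 0" "u * (1 - b $ i) = 0" by linarith+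
        then show ?thesis using u by simp
      qed
    qed
    with \<open>a \<noteq> b\<close> show False by (simp add: vec_eq_iff)
  qed
  then show ?thesis using \<open>x \<in> S\<close> by (simp add: extreme_point_of_def hull_inc)
qed

lemma vertices_relative_poset_polytope:
  "vertices (relative_poset_polytope P r r') = ideal_point r' ` order_ideals P r"
proof
  show "vertices (relative_poset_polytope P r r') \<subseteq> ideal_point r' ` order_ideals P r"
    unfolding vertices_def relative_poset_polytope_def
    using extreme_point_of_convex_hull by blast
  show "ideal_point r' ` order_ideals P r \<subseteq> vertices (relative_poset_polytope P r r')"
    unfolding vertices_def relative_poset_polytope_def
    using extreme_point_of_convex_hull_01[of _ "ideal_point r' ` order_ideals P r"]
    by (fastforce simp: ideal_point_nth)
qed

definition lifted_point :: "'a rel \<Rightarrow> (real ^ 'a \<Rightarrow> real) \<Rightarrow> 'a::finite set \<Rightarrow> (real ^ 'a) \<times> real" where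
  "lifted_point r c J = (ideal_point r J, c (ideal_point r J))"

lemma lifted_point_in_height_region:
  assumes "J \<in> order_ideals P r"
  shows "lifted_point r' c J \<in> height_region (relative_poset_polytope P r r') c"
  using assms unfolding height_region_def lifted_point_def vertices_relative_poset_polytope
  by (auto intro: hull_inc)

lemma convex_height_region: "convex (height_region Q c)"
  unfolding height_region_def by simp

section \<open>The inequality satisfied by weights in the closed cone\<close>

text \<open>The lifts of union and star lie in a common bounded facet, so their midpoint is the
  highest point of the region over its base. The midpoint of the lifts of \<open>J1\<close> and
  \<open>J2\<close> has the same base point, hence is no higher.\<close>

lemma subdivision_cone_supermodular:
  fixes P :: "'a::finite set"
  assumes po: "partial_order_on P r" and po': "partial_order_on P r'" and "r' \<subseteq> r"
    and star: "star_closed P r r'"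
    and c: "regular_subdivision (relative_poset_polytope P r r') c = linearization_triangulation P r r'"
    and J: "J1 \<in> order_ideals P r" "J2 \<in> order_ideals P r"
  shows "c (ideal_point r' J1) + c (ideal_point r' J2)
    \<le> c (ideal_point r' (J1 \<union> J2)) + c (ideal_point r' (ideal_star P r' J1 J2))"
proof -
  let ?Q = "relative_poset_polytope P r r'"
  let ?v = "ideal_point r'"
  define A B where "A = ideal_star P r' J1 J2" and "B = J1 \<union> J2"
  have J': "J1 \<in> order_ideals P r'" "J2 \<in> order_ideals P r'"
    using J order_ideals_mono[OF \<open>r' \<subseteq> r\<close>] by auto
  have A: "A \<in> order_ideals P r" using star J unfolding star_closed_def A_def by blast
  have B: "B \<in> order_ideals P r" using Un_order_ideals J unfolding B_def by blast
  have "A \<subseteq> B" using ideal_star_subset[OF J'] unfolding A_def B_def by blast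
  then obtain l where l: "linearization P r l" "A \<in> order_ideals P l" "B \<in> order_ideals P l"
    using linearization_through_ideals[OF po A B] by blast
  then have "linearization_simplex P l r' \<in> regular_subdivision ?Q c"
    unfolding c linearization_triangulation_def by blast
  then obtain F where F: "F facet_of height_region ?Q c" "bounded F"
    "linearization_simplex P l r' = fst ` F"
    unfolding regular_subdivision_def by blast
  then have face: "F face_of height_region ?Q c" by (simp add: facet_of_def)
  \<comment> \<open>Membership in the simplex only places the vertex of \<open>C\<close> in the
    projection of \<open>F\<close>. Being extreme in the whole polytope, it must be one of the
    points spanning that projection, and these have their lifts in \<open>F\<close>.\<close>
  have in_F: "lifted_point r' c C \<in> F" if C: "C \<in> order_ideals P r" "C \<in> order_ideals P l" for C
  proof -
    have "?v C \<in> convex hull {v \<in> vertices ?Q. (v, c v) \<in> F}"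
      unfolding fst_bounded_face_height_region[OF face F(2), symmetric] F(3)[symmetric]
        linearization_simplex_def using C(2) by (intro hull_inc imageI)
    moreover have "?v C extreme_point_of ?Q"
      using C(1) vertices_relative_poset_polytope[of P r r'] unfolding vertices_def by blast
    moreover have "convex hull {v \<in> vertices ?Q. (v, c v) \<in> F} \<subseteq> ?Q"
      by (rule hull_minimal) (auto simp: vertices_def extreme_point_of_def relative_poset_polytope_def)
    ultimately have "?v C extreme_point_of convex hull {v \<in> vertices ?Q. (v, c v) \<in> F}"
      unfolding extreme_point_of_def by blast
    then show ?thesis using extreme_point_of_convex_hull[of "?v C"] unfolding lifted_point_def by blast
  qed
  have "midpoint (lifted_point r' c A) (lifted_point r' c B) \<in> F"
    using in_F[OF A l(2)] in_F[OF B l(3)] face_of_imp_convex[OF face] by (intro midpoint_in_convex)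
  moreover have "midpoint (lifted_point r' c J1) (lifted_point r' c J2) \<in> height_region ?Q c"
    using J by (intro midpoint_in_convex convex_height_region lifted_point_in_height_region)
  moreover have "?v J1 + ?v J2 = ?v A + ?v B"
    using ideal_point_add[OF po' J'] unfolding A_def B_def by (simp add: add.commute)
  ultimately have "(1 / 2) * (c (?v J1) + c (?v J2)) \<le> (1 / 2) * (c (?v A) + c (?v B))"
    by (intro bounded_face_height_region_top[OF face F(2), of "(1 / 2) *\<^sub>R (?v A + ?v B)"])
      (simp_all add: lifted_point_def midpoint_def)
  then show ?thesis unfolding A_def B_def by simp
qed

lemma closure_subdivision_cone_supermodular:
  fixes P :: "'a::finite set"
  assumes "partial_order_on P r" "partial_order_on P r'" "r' \<subseteq> r" "star_closed P r r'"
    and w: "w \<in> closure (subdivision_cone (relative_poset_polytope P r r')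
                                       (linearization_triangulation P r r'))"
    and J: "J1 \<in> order_ideals P r" "J2 \<in> order_ideals P r"
  shows "w (ideal_point r' J1) + w (ideal_point r' J2)
    \<le> w (ideal_point r' (J1 \<union> J2)) + w (ideal_point r' (ideal_star P r' J1 J2))"
proof -
  let ?H = "{c :: real ^ 'a \<Rightarrow> real. c (ideal_point r' J1) + c (ideal_point r' J2)
    \<le> c (ideal_point r' (J1 \<union> J2)) + c (ideal_point r' (ideal_star P r' J1 J2))}"
  \<comment> \<open>The inequality involves only evaluations at four fixed points, which are
    continuous in the product topology.\<close>
  have "closed ?H" by (intro closed_Collect_le continuous_on_add) simp_all
  moreover have "subdivision_cone (relative_poset_polytope P r r') (linearization_triangulation P r r') \<subseteq> ?H"
    using subdivision_cone_supermodular[OF assms(1-4) _ J] unfolding subdivision_cone_def by blast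
  ultimately show ?thesis using closure_minimal w by blast
qed

section \<open>Counting dimensions: the height region and maximal chains\<close>

text \<open>A triangularity argument: in the principal \<open>r\<close>-ideal of \<open>p\<close>,
  the \<open>r'\<close>-maximal elements are \<open>p\<close> itself, because \<open>r'\<close> is
  contained in \<open>r\<close>, and others strictly \<open>r\<close>-below \<open>p\<close>. The
  latter have smaller principal ideals, so induction applies.\<close>

lemma axis_in_span_ideal_points:
  fixes P :: "'a::finite set"
  assumes po: "partial_order_on P r" and "r' \<subseteq> r" and "p \<in> P"
  shows "axis p (1::real) \<in> span (ideal_point r' ` order_ideals P r)"
  using \<open>p \<in> P\<close>
proof (induction "card {q \<in> P. (q, p) \<in> r}" arbitrary: p rule: less_induct)
  case less
  note rD = partial_order_onD[OF po]
  let ?J = "{q \<in> P. (q, p) \<in> r}"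
  let ?M = "max_elems r' ?J"
  have "?J \<in> order_ideals P r" using rD(3) unfolding order_ideals_def by blast
  have "p \<in> ?M" using rD(2,4) less.prems \<open>r' \<subseteq> r\<close> unfolding max_elems_def by blast
  have below: "axis q (1::real) \<in> span (ideal_point r' ` order_ideals P r)" if q: "q \<in> ?M - {p}" for q
  proof (rule less.hyps)
    show "q \<in> P" using q by (auto simp: max_elems_def)
    have "(q, p) \<in> r" "q \<noteq> p" using q by (auto simp: max_elems_def)
    then have "{q' \<in> P. (q', q) \<in> r} \<subseteq> ?J" "p \<notin> {q' \<in> P. (q', q) \<in> r}" "p \<in> ?J"
      using rD(3)[of _ q p] rD(4)[of p q] rD(2) less.prems by auto
    then show "card {q' \<in> P. (q', q) \<in> r} < card ?J" by (metis (lifting) finite psubset_card_mono psubsetI)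
  qed
  have "ideal_point r' ?J = (\<Sum>q\<in>?M. axis q (1::real))"
    by (simp add: vec_eq_iff ideal_point_nth axis_def sum.If_cases Int_def)
  also have "\<dots> = axis p 1 + (\<Sum>q\<in>?M - {p}. axis q 1)"
    using \<open>p \<in> ?M\<close> by (simp add: sum.remove)
  finally have "axis p 1 = ideal_point r' ?J - (\<Sum>q\<in>?M - {p}. axis q (1::real))" by simp
  also have "\<dots> \<in> span (ideal_point r' ` order_ideals P r)"
    using below \<open>?J \<in> order_ideals P r\<close> by (intro span_diff span_sum span_base[OF imageI])
  finally show ?case .
qed

text \<open>The unit vectors of \<open>P\<close> and the vertical direction give
  \<open>card P + 1\<close> independent vectors. The bound uses \<open>card P\<close>, not the
  ambient dimension, since \<open>P\<close> may be a proper subset of the type.\<close>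

lemma aff_dim_height_region_ge:
  fixes P :: "'a::finite set"
  assumes po: "partial_order_on P r" and "r' \<subseteq> r"
  shows "int (card P) + 1 \<le> aff_dim (height_region (relative_poset_polytope P r r') c)"
proof -
  let ?T = "height_region (relative_poset_polytope P r r') c"
  let ?V = "ideal_point r' ` order_ideals P r"
  \<comment> \<open>Two points of the ray over \<open>v\<close> already span the vertical line
    through it.\<close>
  have affT: "(v, x) \<in> affine hull ?T" if v: "v \<in> ?V" for v x
  proof -
    have T: "(v, c v) \<in> ?T" "(v, c v - 1) \<in> ?T"
      using v unfolding height_region_def vertices_relative_poset_polytope by (auto intro: hull_inc)
    have "(v, c v) + (x - c v) *\<^sub>R ((v, c v) - (v, c v - 1)) \<in> affine hull ?T"
      using T by (intro mem_affine_3_minus affine_affine_hull hull_inc)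
    then show ?thesis by simp
  qed
  \<comment> \<open>The empty ideal puts the origin into the affine hull, which is therefore a
    linear span.\<close>
  have "ideal_point r' {} = 0" by (simp add: vec_eq_iff ideal_point_nth max_elems_def)
  then have "0 \<in> ?V" using empty_order_ideal by (metis image_eqI)
  then have "(0, 0) \<in> affine hull ?T" using affT by blast
  then have zero: "0 \<in> affine hull ?T" by (simp add: zero_prod_def)
  then have span: "affine hull ?T = span ?T" by (rule affine_hull_span_0)
  let ?B = "insert (0, 1) ((\<lambda>p. (axis p (1::real), 0::real)) ` P)"
  have "(u, 0) \<in> span ?T" if "u \<in> span ?V" for u
  proof -
    have "(\<lambda>v. (v, 0::real)) ` span ?V = span ((\<lambda>v. (v, 0)) ` ?V)"
      by (intro linear_span_image[symmetric] linearI) auto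
    also have "\<dots> \<subseteq> span ?T" using affT span by (intro span_minimal) auto
    finally show ?thesis using that by blast
  qed
  then have "?B \<subseteq> span ?T"
    using axis_in_span_ideal_points[OF assms] affT[OF \<open>0 \<in> ?V\<close>] span by auto
  moreover have "?B \<subseteq> Basis"
    by (auto simp: Basis_prod_def Basis_vec_def)
  then have "independent ?B" using independent_Basis independent_mono by blast
  ultimately have "card ?B \<le> dim ?T" using independent_card_le_dim[of ?B "span ?T"] by simp
  moreover have "card ?B = card P + 1"
    by (subst card_insert_disjoint) (auto simp: card_image inj_on_def axis_eq_axis)
  ultimately show ?thesis using aff_dim_zero[OF zero] by simp
qed

text \<open>Induction on \<open>card J\<close>. For the largest chain member \<open>D\<close> not
  containing \<open>J\<close>, the union \<open>D \<union> J\<close> is again in the chain, and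
  \<open>m D J\<close> is a proper subset of \<open>J\<close>. The exchange relation
  \<open>g\<close> then writes the point of \<open>J\<close> as an affine combination of three
  points already in the hull.\<close>

lemma affine_hull_maximal_chain:
  fixes g :: "'a set \<Rightarrow> 'b::real_vector"
  assumes fin: "finite P" and LP: "L \<subseteq> Pow P"
    and Un: "\<And>A B. A \<in> L \<Longrightarrow> B \<in> L \<Longrightarrow> A \<union> B \<in> L"
    and m: "\<And>A B. A \<in> L \<Longrightarrow> B \<in> L \<Longrightarrow> m A B \<in> L"
    and m_sub: "\<And>A B. A \<in> L \<Longrightarrow> B \<in> L \<Longrightarrow> m A B \<subseteq> A \<inter> B"
    and g: "\<And>A B. A \<in> L \<Longrightarrow> B \<in> L \<Longrightarrow> g A + g B = g (A \<union> B) + g (m A B)"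
    and K: "subset.maxchain L K" and "J \<in> L"
  shows "g J \<in> affine hull (g ` K)"
  using \<open>J \<in> L\<close>
proof (induction "card J" arbitrary: J rule: less_induct)
  case less
  have KL: "K \<subseteq> L" and ch: "\<And>X Y. X \<in> K \<Longrightarrow> Y \<in> K \<Longrightarrow> X \<subseteq> Y \<or> Y \<subseteq> X"
    using K unfolding subset.maxchain_def subset_chain_def by auto
  have in_K: "X \<in> K" if X: "X \<in> L" "\<And>Y. Y \<in> K \<Longrightarrow> X \<subseteq> Y \<or> Y \<subseteq> X" for X
  proof (rule ccontr)
    assume "X \<notin> K"
    then have "K \<subset> insert X K" by blast
    moreover have "subset.chain L (insert X K)"
      unfolding subset_chain_def
    proof (intro conjI ballI)
      show "insert X K \<subseteq> L" using X(1) KL by simp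
      show "A \<subseteq> B \<or> B \<subseteq> A" if "A \<in> insert X K" "B \<in> insert X K" for A B
        using that X(2)[of A] X(2)[of B] ch[of A B] by auto
    qed
    ultimately show False using K unfolding subset.maxchain_def by blast
  qed
  let ?E = "{X \<in> K. \<not> J \<subseteq> X}"
  show ?case
  proof (cases "?E = {}")
    case True
    then have "J \<in> K" using in_K less.prems by blast
    then show ?thesis by (intro hull_inc imageI)
  next
    case False
    define D where "D = \<Union>?E"
    have "?E \<subseteq> Pow P" using KL LP by blast
    then have "finite ?E" using fin finite_subset finite_Pow_iff by metis
    moreover have "subset.chain L ?E" using KL ch unfolding subset_chain_def by auto
    ultimately have "D \<in> ?E" unfolding D_def using False by (intro Union_in_chain)
    then have D: "D \<in> K" "\<not> J \<subseteq> D" "D \<in> L" using KL by auto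
    have "D \<union> J \<in> K"
    proof (rule in_K)
      show "D \<union> J \<in> L" using Un D(3) less.prems by blast
      \<comment> \<open>Chain members containing \<open>J\<close> lie above \<open>D\<close>, and
        all others lie below \<open>D\<close> by its choice. Maximality of \<open>K\<close> then
        puts the union into \<open>K\<close>.\<close>
      show "D \<union> J \<subseteq> Y \<or> Y \<subseteq> D \<union> J" if Y: "Y \<in> K" for Y
      proof (cases "J \<subseteq> Y")
        case True
        then have "\<not> Y \<subseteq> D" using D(2) by blast
        then have "D \<subseteq> Y" using ch[OF D(1) Y] by blast
        with True show ?thesis by blast
      next
        case False
        then have "Y \<subseteq> D" unfolding D_def using Y by blast
        then show ?thesis by blast
      qed
    qed
    have "m D J \<subset> J" using m_sub[OF D(3) less.prems] D(2) by blast
    moreover have "J \<subseteq> P" using LP less.prems by blast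
    then have "finite J" using fin by (rule finite_subset)
    ultimately have "g (m D J) \<in> affine hull (g ` K)"
      by (intro less.hyps m[OF D(3) less.prems] psubset_card_mono)
    moreover have "g D \<in> affine hull (g ` K)" "g (D \<union> J) \<in> affine hull (g ` K)"
      using D(1) \<open>D \<union> J \<in> K\<close> by (simp_all add: hull_inc)
    ultimately have "g (m D J) + 1 *\<^sub>R (g (D \<union> J) - g D) \<in> affine hull (g ` K)"
      by (intro mem_affine_3_minus affine_affine_hull)
    moreover have "g J = g (m D J) + 1 *\<^sub>R (g (D \<union> J) - g D)"
      using g[OF D(3) less.prems] by (simp add: algebra_simps)
    ultimately show ?thesis by simp
  qed
qed

theorem theorem2p3p3:
  fixes P :: "('a::finite) set" and r r' :: "'a rel" and w :: "real ^ 'a \<Rightarrow> real"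
  assumes "partial_order_on P r" and "partial_order_on P r'"
    and "r' \<subseteq> r"
    and "star_closed P r r'"
    and "w \<in> closure (subdivision_cone (relative_poset_polytope P r r')
                                       (linearization_triangulation P r r'))"
    and "S \<in> regular_subdivision (relative_poset_polytope P r r') w"
  shows "\<exists>r''. partial_order_on P r'' \<and> r \<subseteq> r'' \<and> star_closed P r'' r' \<and>
               S = relative_poset_polytope P r'' r'"
proof -
  let ?Q = "relative_poset_polytope P r r'"
  let ?T = "height_region ?Q w"
  let ?g = "lifted_point r' w"
  let ?m = "ideal_star P r'"
  obtain F where facet: "F facet_of ?T" and bnd: "bounded F" and S: "S = fst ` F"
    using assms(6) unfolding regular_subdivision_def by blast
  then have F: "F face_of ?T" "F \<noteq> {}" "aff_dim F = aff_dim ?T - 1"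
    by (auto simp: facet_of_def)
  define L where "L = {J \<in> order_ideals P r. ?g J \<in> F}"
  have LI: "L \<subseteq> order_ideals P r" by (auto simp: L_def)
  then have LI': "A \<in> order_ideals P r'" if "A \<in> L" for A
    using that order_ideals_mono[OF assms(3)] by blast
  have F_eq: "F = convex hull (?g ` L)"
  proof -
    have "{(v, w v) | v. v \<in> vertices ?Q \<and> (v, w v) \<in> F} = ?g ` L"
      unfolding vertices_relative_poset_polytope L_def lifted_point_def by blast
    then show ?thesis using bounded_face_height_region_eq[OF F(1) bnd] by simp
  qed
  have S_eq: "S = convex hull (ideal_point r' ` L)"
  proof -
    have "{v \<in> vertices ?Q. (v, w v) \<in> F} = ideal_point r' ` L"
      unfolding vertices_relative_poset_polytope L_def lifted_point_def by blast
    then show ?thesis using fst_bounded_face_height_region[OF F(1) bnd] S by simp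
  qed
  \<comment> \<open>The weight inequality and the fact that points of \<open>F\<close> are highest
    over their base bound the two sums from both sides, so they agree. Thus the midpoint of the
    lifts of \<open>?C\<close> and \<open>?D\<close> lies in \<open>F\<close>, and the face property
    puts both ends there.\<close>
  have closed: "A \<union> B \<in> L \<and> ?m A B \<in> L \<and> ?g A + ?g B = ?g (A \<union> B) + ?g (?m A B)"
    if A: "A \<in> L" and B: "B \<in> L" for A B
  proof -
    let ?C = "A \<union> B" and ?D = "?m A B"
    have AB: "A \<in> order_ideals P r" "B \<in> order_ideals P r" "?g A \<in> F" "?g B \<in> F"
      using A B by (auto simp: L_def)
    then have C: "?C \<in> order_ideals P r" and D: "?D \<in> order_ideals P r"
      using Un_order_ideals assms(4) unfolding star_closed_def by auto
    have low: "midpoint (?g A) (?g B) \<in> F"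
      using AB face_of_imp_convex[OF F(1)] by (intro midpoint_in_convex)
    have high: "midpoint (?g ?C) (?g ?D) \<in> ?T"
      using C D by (intro midpoint_in_convex convex_height_region lifted_point_in_height_region)
    have point_sum: "ideal_point r' A + ideal_point r' B = ideal_point r' ?C + ideal_point r' ?D"
      using ideal_point_add[OF assms(2) LI'[OF A] LI'[OF B]] .
    have "(1 / 2) * (w (ideal_point r' ?C) + w (ideal_point r' ?D))
        \<le> (1 / 2) * (w (ideal_point r' A) + w (ideal_point r' B))"
      using low high point_sum
      by (intro bounded_face_height_region_top[OF F(1) bnd,
            of "(1 / 2) *\<^sub>R (ideal_point r' A + ideal_point r' B)"])
        (simp_all add: lifted_point_def midpoint_def)
    then have g_sum: "?g A + ?g B = ?g ?C + ?g ?D"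
      using closure_subdivision_cone_supermodular[OF assms(1-5) AB(1,2)] point_sum
      by (simp add: lifted_point_def)
    then have mid: "midpoint (?g ?C) (?g ?D) \<in> F" using low by (simp add: midpoint_def)
    have "?g ?C \<in> F \<and> ?g ?D \<in> F"
    \<comment> \<open>The face property speaks of open segments, which are empty when the ends
      coincide.\<close>
    proof (cases "?g ?C = ?g ?D")
      case True
      then show ?thesis using mid by simp
    next
      case False
      then have "midpoint (?g ?C) (?g ?D) \<in> open_segment (?g ?C) (?g ?D)" by simp
      then show ?thesis
        using face_ofD[OF F(1) _ lifted_point_in_height_region[OF C]
            lifted_point_in_height_region[OF D] mid] by blast
    qed
    with C D g_sum show ?thesis by (simp add: L_def)
  qed
  then have Un: "A \<union> B \<in> L" and star: "?m A B \<in> L"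
    and g_sum: "?g A + ?g B = ?g (A \<union> B) + ?g (?m A B)" if "A \<in> L" "B \<in> L" for A B
    using that by blast+
  obtain K where K: "subset.maxchain L K" using subset.Hausdorff by blast
  have LP: "L \<subseteq> Pow P" using LI order_ideals_subset by fast
  have "subset.chain L K" using K by (simp add: subset.maxchain_def)
  then have KL: "K \<subseteq> L" and KP: "subset.chain (Pow P) K"
    using LP by (auto simp: subset_chain_def)
  have "?g J \<in> affine hull (?g ` K)" if "J \<in> L" for J
    by (rule affine_hull_maximal_chain[OF finite LP Un star ideal_star_subset[OF LI' LI'] g_sum K that])
  then have "F \<subseteq> affine hull (?g ` K)"
    unfolding F_eq by (intro hull_minimal affine_imp_convex affine_affine_hull) blast
  \<comment> \<open>The facet has dimension at least \<open>card P\<close>, one less than the bound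
    for the region, while \<open>card K\<close> points span dimension at most
    \<open>card K - 1\<close>. So \<open>K\<close> is long enough to be a full flag.\<close>
  then have "aff_dim F \<le> aff_dim (?g ` K)" using aff_dim_subset by (metis aff_dim_affine_hull)
  also have "\<dots> \<le> int (card (?g ` K)) - 1" by (intro aff_dim_le_card) simp
  also have "\<dots> \<le> int (card K) - 1" using card_image_le[of K ?g] by simp
  finally have "card P + 1 \<le> card K"
    using F(3) aff_dim_height_region_ge[OF assms(1,3), of w] by linarith
  then obtain r'' where r'': "partial_order_on P r''" "r \<subseteq> r''" "order_ideals P r'' = L"
    using star_closed_family_eq_order_ideals[OF finite assms(2,3) partial_order_onD(1)[OF assms(1)]
        LI Un star KL KP] by blast
  moreover have "star_closed P r'' r'" using star r''(3) by (simp add: star_closed_def)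
  moreover have "S = relative_poset_polytope P r'' r'"
    unfolding relative_poset_polytope_def r''(3) by (rule S_eq)
  ultimately show ?thesis by blast
qed

end
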